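(* Let $n\ge4$ be even and let $f=a_1x_1^2+\dots+a_nx_n^2$ with $a_i\in\mathbb{F}_q^\times$ such that $(-1)^{n/2}a_1\cdots a_n$ is a square in $\mathbb{F}_q^\times$. Then for every integer $P\ge1$: $$N(P)=\frac{q^2-1}{q}Pq^{2P}+q^{2P}\quad\text{if }n=4,$$ $$N(P)=\frac{q^{n/2}-1}{q^{n/2-1}-q}\,q^{P(n-2)}-(q-1)\frac{q^{n/2-1}+1}{q^{n/2-1}-q}\,q^{\frac n2P}\quad\text{if }n\ge6.$$
   Context: $q$ is a power of an odd prime. $N(P)=\#\{\mathbf{x}\in\mathbb{F}_q[t]^n:\deg(x_i)<P\text{ for all }i,\ f(\mathbf{x})=0\}$ (with the convention $\deg 0=-\infty$, so $\mathbf{x}=\mathbf{0}$ is counted). *)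

theory Defs
  imports "HOL-Computational_Algebra.Polynomial"
begin

definition N_count :: "nat \<Rightarrow> (nat \<Rightarrow> 'a::{finite,field}) \<Rightarrow> nat \<Rightarrow> nat" where
  "N_count n a P = card {x :: nat \<Rightarrow> 'a poly.
      (\<forall>i<n. x i = 0 \<or> degree (x i) < P) \<and> (\<forall>i\<ge>n. x i = 0) \<and>
      (\<Sum>i<n. smult (a i) ((x i)^2)) = 0}"

end

theory Submission
  imports Defs "HOL-Library.Cardinality"
begin

text \<open>Write $n = 2m$. Over a finite field of odd order the discriminant condition makes the form equivalent
  to $y_1 z_1 + \dots + y_m z_m$ by a constant linear substitution, which respects the degree bounds. Detecting
  the equation by all linear functionals $l$ on the polynomials of degree less than $2P - 1$ gives
  $N(P) = q^{-(2P-1)} \sum_l (q^P k_l)^m$, where $k_l$ is the size of the kernel of the $P \times P$ Hankel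
  matrix of $l$. Let $K_a$ be the kernel of the Hankel matrix of $l$ with $a$ columns and $2P - a$ rows.
  As long as $a < P$, either $K_{a+1} = 0$ or $|K_{a+1}| = q |K_a|$. Together with the first moments
  $\sum_l (|K_a| - 1) = (q^a - 1) q^{a-1}$ this shows that exactly $q^{2a}$ functionals have
  $K_{a+1} \neq 0$, and all the moments of $|K_P|$ follow by recursion on $a$.\<close>

section \<open>Linear functionals on finite spaces of polynomials\<close>

definition poly_subspace :: "'a::field poly set \<Rightarrow> bool" where
  "poly_subspace K \<longleftrightarrow> 0 \<in> K \<and> (\<forall>x\<in>K. \<forall>y\<in>K. x + y \<in> K) \<and> (\<forall>c. \<forall>x\<in>K. smult c x \<in> K)"

definition poly_functional :: "('a::field poly \<Rightarrow> 'a) \<Rightarrow> bool" where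
  "poly_functional \<phi> \<longleftrightarrow> (\<forall>x y. \<phi> (x + y) = \<phi> x + \<phi> y) \<and> (\<forall>c x. \<phi> (smult c x) = c * \<phi> x)"

definition polys_below :: "nat \<Rightarrow> 'a::zero poly set" where
  "polys_below n = {p. p = 0 \<or> degree p < n}"

text \<open>Translation by the multiple \<open>v\<close> of \<open>u\<close> with
  \<open>\<phi> v = c\<close> matches the kernel with the level set.\<close>

lemma card_level_set:
  fixes \<phi> :: "'a::field poly \<Rightarrow> 'a"
  assumes K: "poly_subspace K" and \<phi>: "poly_functional \<phi>"
    and u: "u \<in> K" "\<phi> u \<noteq> 0"
  shows "card {x \<in> K. \<phi> x = c} = card {x \<in> K. \<phi> x = 0}"
proof -
  define v where "v = smult (c / \<phi> u) u"
  have v: "v \<in> K" "smult (-1) v \<in> K" "\<phi> v = c" "\<phi> (- v) = - c"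
    using K \<phi> u unfolding v_def poly_subspace_def poly_functional_def
    by (simp_all flip: smult_minus_left)
  show ?thesis
  proof (rule bij_betw_same_card[of "\<lambda>x. x - v"], rule bij_betw_byWitness[where f' = "\<lambda>x. x + v"])
    have "x - v \<in> K" "\<phi> (x - v) = 0" if "x \<in> K" "\<phi> x = c" for x
    proof -
      have "x + smult (-1) v \<in> K"
        using that K v unfolding poly_subspace_def by blast
      moreover have "\<phi> (x + - v) = \<phi> x + \<phi> (- v)"
        using \<phi> unfolding poly_functional_def by blast
      ultimately have "x + smult (-1) v \<in> K" "\<phi> (x + smult (-1) v) = 0"
        using that v by simp_all
      then show "x - v \<in> K" "\<phi> (x - v) = 0" by simp_all
    qed
    then show "(\<lambda>x. x - v) ` {x \<in> K. \<phi> x = c} \<subseteq> {x \<in> K. \<phi> x = 0}" by auto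
    show "(\<lambda>x. x + v) ` {x \<in> K. \<phi> x = 0} \<subseteq> {x \<in> K. \<phi> x = c}"
      using K \<phi> v unfolding poly_subspace_def poly_functional_def by auto
  qed auto
qed

text \<open>All level sets have the same size, so each value is taken equally often. The main use is
  with weights \<open>g\<close> of sum zero, where the whole sum cancels; this plays the part of
  character orthogonality.\<close>

lemma sum_over_functional:
  fixes \<phi> :: "'a::{finite,field} poly \<Rightarrow> 'a" and g :: "'a \<Rightarrow> real"
  assumes K: "poly_subspace K" "finite K" and \<phi>: "poly_functional \<phi>"
    and u: "u \<in> K" "\<phi> u \<noteq> 0"
  shows "(\<Sum>x\<in>K. g (\<phi> x)) = real (card {x \<in> K. \<phi> x = 0}) * (\<Sum>c\<in>UNIV. g c)"
proof -
  have "(\<Sum>x\<in>K. g (\<phi> x)) = (\<Sum>c\<in>UNIV. \<Sum>x\<in>{x \<in> K. \<phi> x = c}. g (\<phi> x))"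
    by (rule sum.group[symmetric]) (use K in auto)
  also have "\<dots> = (\<Sum>c\<in>UNIV. real (card {x \<in> K. \<phi> x = c}) * g c)"
    by (rule sum.cong) auto
  also have "\<dots> = (\<Sum>c\<in>UNIV. real (card {x \<in> K. \<phi> x = 0}) * g c)"
    by (intro sum.cong refl, subst card_level_set[OF K(1) \<phi> u]) (rule refl)
  finally show ?thesis by (simp add: sum_distrib_left)
qed

lemma card_eq_card_kernel:
  fixes \<phi> :: "'a::{finite,field} poly \<Rightarrow> 'a"
  assumes "poly_subspace K" "finite K" "poly_functional \<phi>" "u \<in> K" "\<phi> u \<noteq> 0"
  shows "card K = CARD('a) * card {x \<in> K. \<phi> x = 0}"
proof -
  have "real (card K) = real (CARD('a) * card {x \<in> K. \<phi> x = 0})"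
    using sum_over_functional[OF assms, of "\<lambda>_. 1"] by simp
  then show ?thesis by (simp only: of_nat_eq_iff)
qed

section \<open>Polynomials of bounded degree and the coefficient pairing\<close>

lemma polys_below_iff: "p \<in> polys_below n \<longleftrightarrow> (\<forall>i\<ge>n. coeff p i = 0)"
proof (cases "p = 0")
  case False
  then show ?thesis
    unfolding polys_below_def using le_degree coeff_eq_0
    by (metis (mono_tags, lifting) leading_coeff_0_iff linorder_not_less mem_Collect_eq order_less_le_trans)
qed (simp add: polys_below_def)

lemma polys_below_if_coeff_0:
  assumes "p \<in> polys_below (Suc n)" "coeff p n = 0"
  shows "p \<in> polys_below n"
  unfolding polys_below_iff
proof (intro allI impI)
  fix i assume "n \<le> i"
  then show "coeff p i = 0"
    using assms by (cases "i = n") (auto simp: polys_below_iff)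
qed

lemma polys_below_0 [simp]: "polys_below 0 = {0}"
  by (auto simp: polys_below_def)

lemma polys_below_mono: "m \<le> n \<Longrightarrow> polys_below m \<subseteq> polys_below n"
  by (auto simp: polys_below_def)

lemma poly_subspace_polys_below: "poly_subspace (polys_below n)"
  by (simp add: poly_subspace_def polys_below_iff)

lemma zero_in_polys_below [simp]: "0 \<in> polys_below n"
  by (simp add: polys_below_def)

text \<open>Degrees add. If \<open>a\<close> or \<open>b\<close> is 0, the product is 0, so the
  truncated subtraction does no harm.\<close>

lemma mult_in_polys_below:
  fixes y z :: "'a::field poly"
  assumes "y \<in> polys_below a" "z \<in> polys_below b"
  shows "y * z \<in> polys_below (a + b - 1)"
  using assms unfolding polys_below_def by (cases "y = 0"; cases "z = 0") (auto simp: degree_mult_eq)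

lemma polys_below_Suc: "polys_below (Suc n) = (\<lambda>(c, p). pCons c p) ` (UNIV \<times> polys_below n)"
proof (intro equalityI subsetI)
  fix p :: "'a poly" assume p: "p \<in> polys_below (Suc n)"
  obtain c r where "p = pCons c r" by (cases p)
  moreover have "r \<in> polys_below n"
    unfolding polys_below_iff
  proof (intro allI impI)
    fix i assume "n \<le> i"
    then have "coeff p (Suc i) = 0" using p by (simp add: polys_below_iff)
    then show "coeff r i = 0" using \<open>p = pCons c r\<close> by simp
  qed
  ultimately show "p \<in> (\<lambda>(c, p). pCons c p) ` (UNIV \<times> polys_below n)" by auto
next
  fix p :: "'a poly" assume "p \<in> (\<lambda>(c, p). pCons c p) ` (UNIV \<times> polys_below n)"
  then show "p \<in> polys_below (Suc n)"
    by (auto simp: polys_below_iff coeff_pCons split: nat.split)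
qed

lemma finite_card_polys_below:
  "finite (polys_below n :: 'a::{finite,field} poly set) \<and>
   card (polys_below n :: 'a poly set) = CARD('a) ^ n"
proof (induction n)
  case (Suc n)
  have "inj_on (\<lambda>(c :: 'a, p). pCons c p) (UNIV \<times> polys_below n)"
    by (auto simp: inj_on_def)
  then show ?case
    using Suc by (simp add: polys_below_Suc card_image card_cartesian_product)
qed simp

lemmas finite_polys_below [simp] = finite_card_polys_below[THEN conjunct1]
lemmas card_polys_below = finite_card_polys_below[THEN conjunct2]

text \<open>A functional on the polynomials of degree less than $N$ is encoded by the polynomial \<open>l\<close> of
  degree less than $N$ whose coefficients are its values on the monomials.\<close>
definition pairing :: "nat \<Rightarrow> 'a::field poly \<Rightarrow> 'a poly \<Rightarrow> 'a" where
  "pairing N l y = (\<Sum>i<N. coeff l i * coeff y i)"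

lemma poly_functional_pairing: "poly_functional (pairing N l)"
  by (auto simp: poly_functional_def pairing_def sum.distrib algebra_simps sum_distrib_left)

lemma poly_functional_pairing_left: "poly_functional (\<lambda>l. pairing N l y)"
  by (auto simp: poly_functional_def pairing_def sum.distrib algebra_simps sum_distrib_left)

lemma poly_functional_pairing_mult: "poly_functional (\<lambda>z. pairing N l (y * z))"
  using poly_functional_pairing[of N l] by (simp add: poly_functional_def distrib_left)

lemma pairing_add_right: "pairing N l (x + y) = pairing N l x + pairing N l y"
  using poly_functional_pairing[of N l] by (simp add: poly_functional_def)

lemma pairing_smult_right: "pairing N l (smult c x) = c * pairing N l x"
  using poly_functional_pairing[of N l] by (simp add: poly_functional_def)

lemma pairing_0_right [simp]: "pairing N l 0 = 0"
  by (simp add: pairing_def)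

text \<open>The pairing is nondegenerate: the monomial at the degree of \<open>w\<close> reads off
  its leading coefficient.\<close>

lemma exists_pairing_nonzero:
  assumes "w \<in> polys_below N" "w \<noteq> (0 :: 'a::field poly)"
  shows "\<exists>l\<in>polys_below N. pairing N l w \<noteq> 0"
proof
  have d: "degree w < N" using assms by (auto simp: polys_below_def)
  show "monom 1 (degree w) \<in> (polys_below N :: 'a poly set)"
    using d by (simp add: polys_below_def degree_monom_eq)
  have "pairing N (monom 1 (degree w)) w = (\<Sum>i<N. if degree w = i then coeff w i else 0)"
    unfolding pairing_def by (rule sum.cong) auto
  also have "\<dots> = lead_coeff w" using d by simp
  finally show "pairing N (monom 1 (degree w)) w \<noteq> 0" using assms by simp
qed

text \<open>The normalised sum of the nontrivial additive characters: it sums to zero, so it detects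
  vanishing without any characters.\<close>
definition balanced_delta :: "'a::{finite,field} \<Rightarrow> real" where
  "balanced_delta c = of_bool (c = 0) - 1 / real CARD('a)"

lemma card_field_gt_1: "CARD('a::{finite,field}) > 1"
proof -
  have "card {0, 1 :: 'a} \<le> CARD('a)" by (rule card_mono) auto
  then show ?thesis by simp
qed

lemma sum_balanced_delta [simp]: "(\<Sum>c\<in>UNIV. balanced_delta (c :: 'a::{finite,field})) = 0"
  using card_field_gt_1[where 'a = 'a]
  by (simp add: balanced_delta_def sum_subtractf of_bool_def)

lemma balanced_delta_0_pos: "balanced_delta (0 :: 'a::{finite,field}) > 0"
  using card_field_gt_1[where 'a = 'a] by (simp add: balanced_delta_def field_simps)

text \<open>For \<open>w\<close> nonzero, \<open>pairing N l w\<close> is a nonzero functional of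
  \<open>l\<close>, so the balanced weights cancel; for \<open>w = 0\<close> every \<open>l\<close>
  contributes the same.\<close>

lemma sum_balanced_delta_pairing:
  fixes w :: "'a::{finite,field} poly"
  assumes "w \<in> polys_below N"
  shows "(\<Sum>l\<in>polys_below N. balanced_delta (pairing N l w))
    = of_bool (w = 0) * real CARD('a) ^ N * balanced_delta (0 :: 'a)"
proof (cases "w = 0")
  case True
  then show ?thesis by (simp add: card_polys_below)
next
  case False
  then obtain l where "l \<in> polys_below N" "pairing N l w \<noteq> 0"
    using exists_pairing_nonzero assms by blast
  from sum_over_functional[OF poly_subspace_polys_below finite_polys_below
      poly_functional_pairing_left this, of balanced_delta]
  show ?thesis using False by simp
qed

section \<open>Hankel kernels and their first moment\<close>

text \<open>A matrix-free form of the kernel of the Hankel matrix with entries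
  \<open>coeff l (i + j)\<close>, \<open>a\<close> columns and \<open>b\<close> rows. It is this
  kernel when \<open>a + b = Suc N\<close>, since the products then have degree less than
  \<open>N\<close> and \<open>pairing N\<close> sees all their coefficients.\<close>

definition hankel_kernel :: "nat \<Rightarrow> 'a::field poly \<Rightarrow> nat \<Rightarrow> nat \<Rightarrow> 'a poly set" where
  "hankel_kernel N l a b = {y \<in> polys_below a. \<forall>z\<in>polys_below b. pairing N l (y * z) = 0}"

lemma finite_hankel_kernel [simp]: "finite (hankel_kernel N (l :: 'a::{finite,field} poly) a b)"
  by (simp add: hankel_kernel_def)

lemma poly_subspace_hankel_kernel: "poly_subspace (hankel_kernel N l a b)"
  using poly_subspace_polys_below[of a]
  by (auto simp: poly_subspace_def hankel_kernel_def distrib_right pairing_add_right pairing_smult_right)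

lemma zero_in_hankel_kernel [simp]: "0 \<in> hankel_kernel N l a b"
  by (simp add: hankel_kernel_def)

lemma hankel_kernel_mono: "hankel_kernel N l a (Suc b) \<subseteq> hankel_kernel N l (Suc a) b"
  using polys_below_mono[of a "Suc a"] polys_below_mono[of b "Suc b"]
  by (fastforce simp: hankel_kernel_def)

text \<open>As a functional of \<open>z\<close>, the pairing with \<open>y * z\<close> either
  vanishes throughout or takes every value equally often, and then the weights cancel.\<close>

lemma sum_hankel_row:
  fixes l :: "'a::{finite,field} poly" and g :: "'a \<Rightarrow> real"
  assumes "y \<in> polys_below a" and g: "(\<Sum>c\<in>UNIV. g c) = 0"
  shows "(\<Sum>z\<in>polys_below b. g (pairing N l (y * z)))
    = of_bool (y \<in> hankel_kernel N l a b) * real CARD('a) ^ b * g 0"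
proof (cases "y \<in> hankel_kernel N l a b")
  case True
  then have "(\<Sum>z\<in>polys_below b. g (pairing N l (y * z))) = (\<Sum>z\<in>(polys_below b :: 'a poly set). g 0)"
    by (intro sum.cong) (auto simp: hankel_kernel_def)
  then show ?thesis using True by (simp add: card_polys_below)
next
  case False
  then obtain z where "z \<in> polys_below b" "pairing N l (y * z) \<noteq> 0"
    using assms by (auto simp: hankel_kernel_def)
  from sum_over_functional[OF poly_subspace_polys_below finite_polys_below
      poly_functional_pairing_mult this, of g]
  show ?thesis using False g by simp
qed

text \<open>The double sum \<open>?S\<close> is evaluated in both orders. Summing over
  \<open>z\<close> first counts the wanted \<open>l\<close>; summing over \<open>l\<close> first
  leaves only \<open>z = 0\<close>, because \<open>y * z = 0\<close> forces
  \<open>z = 0\<close>.\<close>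

lemma card_annihilator:
  fixes y :: "'a::{finite,field} poly"
  assumes y: "y \<in> polys_below a" "y \<noteq> 0" and ab: "a + b = Suc N"
  shows "real (card {l \<in> polys_below N. y \<in> hankel_kernel N l a b}) = real CARD('a) ^ (a - 1)"
proof -
  let ?W = "polys_below N :: 'a poly set" and ?d = "balanced_delta (0 :: 'a)"
  let ?q = "real CARD('a)"
  let ?S = "\<Sum>l\<in>?W. \<Sum>z\<in>polys_below b. balanced_delta (pairing N l (y * z))"
  \<comment> \<open>A nonzero \<open>y\<close> forces \<open>a > 0\<close>, so \<open>a - 1\<close>
    is a true difference.\<close>
  have N: "N = b + (a - 1)" using y ab by (cases a) auto
  have "?S = (\<Sum>l\<in>?W. of_bool (y \<in> hankel_kernel N l a b) * (?q ^ b * ?d))"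
    by (simp add: sum_hankel_row[OF y(1)] mult.assoc)
  also have "\<dots> = real (card {l \<in> ?W. y \<in> hankel_kernel N l a b}) * (?q ^ b * ?d)"
    by (simp add: sum_distrib_right[symmetric] Int_def)
  finally have 1: "?S = real (card {l \<in> ?W. y \<in> hankel_kernel N l a b}) * (?q ^ b * ?d)" .
  have "?S = (\<Sum>z\<in>polys_below b. \<Sum>l\<in>?W. balanced_delta (pairing N l (y * z)))"
    by (rule sum.swap)
  also have "\<dots> = (\<Sum>z\<in>(polys_below b :: 'a poly set). of_bool (z = 0) * (?q ^ N * ?d))"
  proof (rule sum.cong)
    fix z :: "'a poly" assume "z \<in> polys_below b"
    then have "y * z \<in> ?W" using mult_in_polys_below[OF y(1), of z b] ab by simp
    then show "(\<Sum>l\<in>?W. balanced_delta (pairing N l (y * z))) = of_bool (z = 0) * (?q ^ N * ?d)"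
      using y by (simp add: sum_balanced_delta_pairing)
  qed simp
  also have "\<dots> = ?q ^ N * ?d"
    by (simp add: of_bool_def if_distrib[of "\<lambda>x. x * _"] cong: if_cong)
  finally have "real (card {l \<in> ?W. y \<in> hankel_kernel N l a b}) * (?q ^ b * ?d) = ?q ^ N * ?d"
    using 1 by simp
  then show ?thesis
    using balanced_delta_0_pos[where 'a = 'a] card_field_gt_1[where 'a = 'a] by (simp add: N power_add)
qed

text \<open>Double counting of pairs of a functional and a nonzero kernel element.\<close>

lemma sum_card_hankel_kernel:
  assumes ab: "a + b = Suc N"
  shows "(\<Sum>l\<in>(polys_below N :: 'a::{finite,field} poly set). real (card (hankel_kernel N l a b)) - 1)
    = (real CARD('a) ^ a - 1) * real CARD('a) ^ (a - 1)"
proof -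
  let ?W = "polys_below N :: 'a poly set" and ?V = "polys_below a - {0 :: 'a poly}"
  have "real (card (hankel_kernel N l a b)) - 1 = (\<Sum>y\<in>?V. of_bool (y \<in> hankel_kernel N l a b))" for l :: "'a poly"
  proof -
    have "?V \<inter> hankel_kernel N l a b = hankel_kernel N l a b - {0}"
      by (auto simp: hankel_kernel_def)
    moreover have "card (hankel_kernel N l a b) > 0"
      using zero_in_hankel_kernel[of N l a b] by (auto simp: card_gt_0_iff simp del: zero_in_hankel_kernel)
    ultimately show ?thesis by (simp add: of_nat_diff Suc_le_eq)
  qed
  then have "(\<Sum>l\<in>?W. real (card (hankel_kernel N l a b)) - 1)
      = (\<Sum>y\<in>?V. \<Sum>l\<in>?W. of_bool (y \<in> hankel_kernel N l a b))"
    by (subst sum.swap) simp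
  also have "\<dots> = (\<Sum>y\<in>?V. real CARD('a) ^ (a - 1))"
    by (rule sum.cong) (auto simp: Int_def card_annihilator[OF _ _ ab])
  also have "\<dots> = real (card ?V) * real CARD('a) ^ (a - 1)" by simp
  also have "real (card ?V) = real CARD('a) ^ a - 1"
    using card_field_gt_1[where 'a = 'a] by (simp add: card_polys_below of_nat_diff)
  finally show ?thesis .
qed

section \<open>Trading a row for a column\<close>

text \<open>Modulo lower terms the only new test polynomial is \<open>monom 1 b\<close>, so an extra
  row costs a single linear condition.\<close>

lemma hankel_kernel_Suc_right:
  fixes y :: "'a::field poly"
  shows "y \<in> hankel_kernel N l a (Suc b) \<longleftrightarrow>
    y \<in> hankel_kernel N l a b \<and> pairing N l (y * monom 1 b) = 0"
proof safe
  assume y: "y \<in> hankel_kernel N l a (Suc b)"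
  then show "y \<in> hankel_kernel N l a b"
    using polys_below_mono[of b "Suc b"] by (auto simp: hankel_kernel_def)
  have "(monom 1 b :: 'a poly) \<in> polys_below (Suc b)" by (simp add: polys_below_iff)
  then show "pairing N l (y * monom 1 b) = 0" using y by (simp add: hankel_kernel_def)
next
  assume y: "y \<in> hankel_kernel N l a b" and 0: "pairing N l (y * monom 1 b) = 0"
  have "pairing N l (y * z) = 0" if z: "z \<in> polys_below (Suc b)" for z
  proof -
    define r where "r = z - monom (coeff z b) b"
    have r: "r \<in> polys_below b"
      using z unfolding r_def polys_below_iff by (auto simp: Suc_le_eq)
    have "z = r + smult (coeff z b) (monom 1 b)" by (simp add: r_def smult_monom)
    then have "y * z = y * r + smult (coeff z b) (y * monom 1 b)"
      by (metis distrib_left mult_smult_right)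
    then show ?thesis
      using y 0 r by (simp add: pairing_add_right pairing_smult_right hankel_kernel_def)
  qed
  then show "y \<in> hankel_kernel N l a (Suc b)" using y by (simp add: hankel_kernel_def)
qed

text \<open>Once the kernel contains some \<open>y\<close> of full degree \<open>a\<close>, the
  condition from the new row holds automatically for elements of lower degree, so only the top
  coefficient cuts the kernel down.\<close>

lemma hankel_kernel_decrease_if_top_degree:
  assumes y: "y \<in> hankel_kernel N l (Suc a) b" "coeff y a \<noteq> 0" and ab: "a \<le> b"
  shows "hankel_kernel N l a (Suc b) = {w \<in> hankel_kernel N l (Suc a) b. coeff w a = 0}"
proof (intro equalityI subsetI)
  fix w assume "w \<in> hankel_kernel N l a (Suc b)"
  then show "w \<in> {w \<in> hankel_kernel N l (Suc a) b. coeff w a = 0}"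
    using hankel_kernel_mono[of N l a b] by (auto simp: hankel_kernel_def polys_below_iff)
next
  fix w assume "w \<in> {w \<in> hankel_kernel N l (Suc a) b. coeff w a = 0}"
  then have w: "w \<in> hankel_kernel N l (Suc a) b" and w0: "coeff w a = 0" by auto
  from w w0 have wa: "w \<in> polys_below a"
    by (auto simp: hankel_kernel_def intro: polys_below_if_coeff_0)
  define r where "r = y - monom (coeff y a) a"
  define t where "t = (monom 1 (b - a) :: 'a poly)"
  have r: "r \<in> polys_below a"
    using y unfolding r_def hankel_kernel_def polys_below_iff by (auto simp: Suc_le_eq)
  have t: "t \<in> polys_below (Suc (b - a))" by (simp add: t_def polys_below_iff)
  have shift: "x * t \<in> polys_below b" if "x \<in> polys_below a" for x
    using mult_in_polys_below[OF that t] ab by simp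
  \<comment> \<open>\<open>w\<close> times the top term of \<open>y\<close> is \<open>w y - w r\<close>, up to a common shift by \<open>t\<close>.\<close>
  have "w * (r * t) + smult (coeff y a) (w * monom 1 b) = y * (w * t)"
  proof -
    have "smult (coeff y a) (monom 1 b) = monom (coeff y a) a * t"
      using ab by (simp add: t_def smult_monom mult_monom)
    then have "smult (coeff y a) (w * monom 1 b) = w * (monom (coeff y a) a * t)"
      by (metis mult_smult_right)
    then show ?thesis by (simp add: r_def algebra_simps)
  qed
  then have "pairing N l (w * (r * t)) + coeff y a * pairing N l (w * monom 1 b)
      = pairing N l (y * (w * t))"
    by (metis pairing_add_right pairing_smult_right)
  moreover have "pairing N l (w * (r * t)) = 0" "pairing N l (y * (w * t)) = 0"
    using w y shift[OF r] shift[OF wa] by (simp_all add: hankel_kernel_def)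
  ultimately have "pairing N l (w * monom 1 b) = 0" using y by simp
  moreover have "w \<in> hankel_kernel N l a b" using w wa by (simp add: hankel_kernel_def)
  ultimately show "w \<in> hankel_kernel N l a (Suc b)" by (simp add: hankel_kernel_Suc_right)
qed

text \<open>A factor of the variable moves freely between \<open>y\<close> and the test polynomial;
  this is the Hankel symmetry.\<close>

lemma pCons_0_in_hankel_kernel:
  fixes y :: "'a::field poly"
  assumes "y \<in> hankel_kernel N l a (Suc b)"
  shows "pCons 0 y \<in> hankel_kernel N l (Suc a) b"
proof -
  have shift: "pCons 0 x \<in> polys_below (Suc n)" if "x \<in> polys_below n" for x :: "'a poly" and n
    using that by (auto simp: polys_below_Suc)
  have "pairing N l (pCons 0 y * z) = 0" if "z \<in> polys_below b" for z
  proof -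
    have "pairing N l (y * pCons 0 z) = 0"
      using assms shift[OF that] unfolding hankel_kernel_def by blast
    then show ?thesis by simp
  qed
  then show ?thesis using assms shift by (simp add: hankel_kernel_def)
qed

text \<open>The smaller kernel is a hyperplane in the larger one. If the coefficient at
  \<open>a\<close> is not identically zero on the larger kernel, it is the defining functional;
  otherwise the condition of the new row is, and it cannot vanish identically.\<close>

lemma card_hankel_kernel_step:
  fixes l :: "'a::{finite,field} poly"
  assumes ab: "a \<le> b" and nz: "hankel_kernel N l (Suc a) b \<noteq> {0}"
  shows "card (hankel_kernel N l (Suc a) b) = CARD('a) * card (hankel_kernel N l a (Suc b))"
proof (cases "\<exists>y\<in>hankel_kernel N l (Suc a) b. coeff y a \<noteq> 0")
  case True
  then obtain y where y: "y \<in> hankel_kernel N l (Suc a) b" "coeff y a \<noteq> 0" by blast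
  have "poly_functional (\<lambda>w :: 'a poly. coeff w a)" by (simp add: poly_functional_def)
  from card_eq_card_kernel[OF poly_subspace_hankel_kernel finite_hankel_kernel this y]
  show ?thesis using hankel_kernel_decrease_if_top_degree[OF y ab] by simp
next
  case False
  let ?K = "hankel_kernel N l (Suc a) b"
  have "w \<in> polys_below a" if "w \<in> ?K" for w
    using False that by (auto simp: hankel_kernel_def intro: polys_below_if_coeff_0)
  then have "w \<in> hankel_kernel N l a b" if "w \<in> ?K" for w
    using that by (simp add: hankel_kernel_def)
  then have dec: "hankel_kernel N l a (Suc b) = {w \<in> ?K. pairing N l (monom 1 b * w) = 0}"
    using hankel_kernel_mono[of N l a b] by (auto simp: hankel_kernel_Suc_right mult.commute)
  have "\<exists>u\<in>?K. pairing N l (monom 1 b * u) \<noteq> 0"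
  proof (rule ccontr)
    \<comment> \<open>Otherwise multiplication by the variable maps \<open>?K\<close> into itself, although it raises degrees.\<close>
    assume "\<not> ?thesis"
    then have "pCons 0 y \<in> ?K" if "y \<in> ?K" for y
      using that dec pCons_0_in_hankel_kernel[of y N l a b] by auto
    moreover define d where "d = Max (degree ` (?K - {0}))"
    have ne: "degree ` (?K - {0}) \<noteq> {}" using nz zero_in_hankel_kernel[of N l "Suc a" b] by blast
    have "d \<in> degree ` (?K - {0})" unfolding d_def by (rule Max_in) (use ne in auto)
    then obtain y where y: "y \<in> ?K" "y \<noteq> 0" "degree y = d" by auto
    ultimately have "pCons 0 y \<in> ?K - {0}" by simp
    then have "degree (pCons 0 y) \<in> degree ` (?K - {0})" by blast
    then have "degree (pCons 0 y) \<le> d" unfolding d_def by (intro Max_ge) simp_all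
    then show False using y by simp
  qed
  then obtain u where "u \<in> ?K" "pairing N l (monom 1 b * u) \<noteq> 0" by blast
  from card_eq_card_kernel[OF poly_subspace_hankel_kernel finite_hankel_kernel
      poly_functional_pairing_mult this]
  show ?thesis using dec by simp
qed

section \<open>Moments of the kernel size\<close>

text \<open>Subtracting 1 makes trivial kernels contribute 0, which merges the trivial case and the
  factor \<open>CARD('a)\<close> into one relation that is linear after summing over
  \<open>l\<close>.\<close>

lemma card_hankel_kernel_power_step:
  fixes l :: "'a::{finite,field} poly"
  assumes ab: "a \<le> b"
  shows "real (card (hankel_kernel N l (Suc a) b)) ^ m - 1
    = real CARD('a) ^ m * (real (card (hankel_kernel N l a (Suc b))) ^ m - 1)
      + (real CARD('a) ^ m - 1) * of_bool (hankel_kernel N l (Suc a) b \<noteq> {0})"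
proof (cases "hankel_kernel N l (Suc a) b = {0}")
  case True
  then have "hankel_kernel N l a (Suc b) = {0}"
    using hankel_kernel_mono[of N l a b] zero_in_hankel_kernel[of N l a "Suc b"] by auto
  then show ?thesis using True by simp
next
  case False
  then show ?thesis
    using card_hankel_kernel_step[OF ab False] by (simp add: power_mult_distrib algebra_simps)
qed

text \<open>In the power step with \<open>m = 1\<close>, both first moments are already known, so
  the number of nontrivial kernels can be solved for.\<close>

lemma card_singular_hankel:
  assumes ab: "a \<le> b"
  shows "(\<Sum>l\<in>(polys_below (a + b) :: 'a::{finite,field} poly set).
      of_bool (hankel_kernel (a + b) l (Suc a) b \<noteq> {0})) = real CARD('a) ^ (2 * a)"
proof -
  let ?W = "polys_below (a + b) :: 'a poly set" and ?q = "real CARD('a)" and ?K = "hankel_kernel (a + b)"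
  let ?T = "\<Sum>l\<in>?W. of_bool (?K l (Suc a) b \<noteq> {0}) :: real"
  have "(\<Sum>l\<in>?W. real (card (?K l (Suc a) b)) - 1)
      = (\<Sum>l\<in>?W. ?q * (real (card (?K l a (Suc b))) - 1) + (?q - 1) * of_bool (?K l (Suc a) b \<noteq> {0}))"
    by (rule sum.cong[OF refl]) (use card_hankel_kernel_power_step[OF ab, where m = 1 and 'a = 'a] in simp)
  also have "\<dots> = ?q * (\<Sum>l\<in>?W. real (card (?K l a (Suc b))) - 1) + (?q - 1) * ?T"
    by (simp only: sum.distrib sum_distrib_left)
  finally have "(?q ^ Suc a - 1) * ?q ^ a = ?q * ((?q ^ a - 1) * ?q ^ (a - 1)) + (?q - 1) * ?T"
    using sum_card_hankel_kernel[of "Suc a" b "a + b", where 'a = 'a]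
      sum_card_hankel_kernel[of a "Suc b" "a + b", where 'a = 'a] by simp
  \<comment> \<open>For \<open>a = 0\<close> the exponent \<open>a - 1\<close> truncates, but both
    sides are then 0.\<close>
  moreover have "?q * ((?q ^ a - 1) * ?q ^ (a - 1)) = (?q ^ a - 1) * ?q ^ a"
    by (cases a) auto
  ultimately have "(?q * ?q ^ a - 1) * ?q ^ a = (?q ^ a - 1) * ?q ^ a + (?q - 1) * ?T" by simp
  moreover have "(q - 1) * T = (q - 1) * (A * A)"
    if "(q * A - 1) * A = (A - 1) * A + (q - 1) * T" for q A T :: real
    using that by (simp add: algebra_simps)
  ultimately have "(?q - 1) * ?T = (?q - 1) * ?q ^ (2 * a)"
    by (simp only: mult_2 power_add)
  then show ?thesis using card_field_gt_1[where 'a = 'a] by simp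
qed

text \<open>Unrolls the power step: the step from \<open>i\<close> to \<open>Suc i\<close> columns
  adds \<open>q ^ (2 * i)\<close> for the nontrivial kernels, and each later step multiplies this by
  \<open>q ^ m\<close>. The bound \<open>2 * a \<le> N + 2\<close> keeps
  \<open>i \<le> N - i\<close> in every step.\<close>

lemma sum_card_hankel_kernel_power:
  assumes "2 * a \<le> N + 2" "a \<le> Suc N"
  shows "(\<Sum>l\<in>(polys_below N :: 'a::{finite,field} poly set).
      real (card (hankel_kernel N l a (Suc N - a))) ^ m - 1)
    = (real CARD('a) ^ m - 1) * (\<Sum>i<a. (real CARD('a) ^ 2) ^ i * (real CARD('a) ^ m) ^ (a - Suc i))"
  using assms
proof (induction a)
  case 0
  have "hankel_kernel N l 0 b = {0}" for l :: "'a poly" and b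
    by (auto simp: hankel_kernel_def)
  then show ?case by simp
next
  case (Suc a)
  let ?W = "polys_below N :: 'a poly set" and ?q = "real CARD('a)" and ?K = "hankel_kernel N"
  define b where "b = N - a"
  have b: "Suc N - Suc a = b" "Suc N - a = Suc b" "N = a + b" "a \<le> b" using Suc.prems by (auto simp: b_def)
  let ?S = "\<lambda>a. \<Sum>i<a. (?q ^ 2) ^ i * (?q ^ m) ^ (a - Suc i)"
  have "(\<Sum>l\<in>?W. real (card (?K l (Suc a) b)) ^ m - 1)
      = (\<Sum>l\<in>?W. ?q ^ m * (real (card (?K l a (Suc b))) ^ m - 1)
          + (?q ^ m - 1) * of_bool (?K l (Suc a) b \<noteq> {0}))"
    by (rule sum.cong[OF refl card_hankel_kernel_power_step]) (rule b)
  also have "\<dots> = ?q ^ m * (\<Sum>l\<in>?W. real (card (?K l a (Suc b))) ^ m - 1)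
      + (?q ^ m - 1) * (\<Sum>l\<in>?W. of_bool (?K l (Suc a) b \<noteq> {0}))"
    by (simp only: sum.distrib sum_distrib_left)
  also have "\<dots> = ?q ^ m * ((?q ^ m - 1) * ?S a) + (?q ^ m - 1) * ?q ^ (2 * a)"
    using Suc card_singular_hankel[OF b(4), where 'a = 'a] b by simp
  finally have "(\<Sum>l\<in>?W. real (card (?K l (Suc a) b)) ^ m - 1)
      = ?q ^ m * ((?q ^ m - 1) * ?S a) + (?q ^ m - 1) * ?q ^ (2 * a)" .
  moreover have "?S (Suc a) = ?q ^ m * ?S a + ?q ^ (2 * a)"
  proof -
    have "?q ^ m * ?S a = (\<Sum>i<a. (?q ^ 2) ^ i * (?q ^ m) ^ (Suc a - Suc i))"
      unfolding sum_distrib_left by (rule sum.cong) (auto simp: Suc_diff_Suc simp flip: power_Suc)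
    then show ?thesis by (simp add: power_mult)
  qed
  ultimately show ?case using b by (simp add: algebra_simps)
qed

section \<open>Squares and binary forms over a finite field\<close>

text \<open>Translation by 1 permutes the field, so \<open>of_nat CARD('a) = 0\<close>; with
  \<open>2 = 0\<close> and odd order it would also be 1.\<close>

lemma two_neq_0_if_odd_card:
  assumes "odd CARD('a::{finite,field})"
  shows "(2 :: 'a) \<noteq> 0"
proof
  assume 2: "(2 :: 'a) = 0"
  have "(\<Sum>x\<in>UNIV. x) = (\<Sum>x\<in>UNIV. x + 1 :: 'a)"
    by (rule sum.reindex_bij_witness[of _ "\<lambda>x. x + 1" "\<lambda>x. x - 1"]) simp_all
  also have "\<dots> = (\<Sum>x\<in>UNIV. x) + of_nat CARD('a)"
    by (simp only: sum.distrib sum_constant mult_1_right)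
  finally have 0: "of_nat CARD('a) = (0 :: 'a)" by (simp only: add_cancel_right_right)
  obtain k where k: "CARD('a) = 2 * k + 1" using assms by (elim oddE)
  have "of_nat CARD('a) = (1 :: 'a)"
    unfolding k by (simp only: of_nat_add of_nat_mult of_nat_numeral 2 mult_zero_left add_0 of_nat_1)
  with 0 show False by simp
qed

text \<open>Each nonzero square has at most two roots, and 0 has only one, so squares make up more
  than half of the field.\<close>

lemma card_squares:
  "CARD('a::{finite,field}) < 2 * card (range (\<lambda>x :: 'a. x\<^sup>2))"
proof -
  let ?S = "range (\<lambda>x :: 'a. x\<^sup>2)"
  have "card (UNIV - {0 :: 'a}) \<le> card (\<Union>s\<in>?S - {0}. {x. x\<^sup>2 = s})"
    by (rule card_mono) auto
  also have "\<dots> \<le> (\<Sum>s\<in>?S - {0}. card {x. x\<^sup>2 = s})"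
    by (rule card_UN_le) simp
  also have "\<dots> \<le> (\<Sum>s\<in>?S - {0}. 2)"
  proof (rule sum_mono)
    fix s :: 'a assume "s \<in> ?S - {0}"
    then obtain r where "s = r\<^sup>2" by auto
    then have "{x. x\<^sup>2 = s} \<subseteq> {r, - r}" by (auto simp: power2_eq_iff)
    then have "card {x. x\<^sup>2 = s} \<le> card {r, - r}" by (intro card_mono) auto
    also have "\<dots> \<le> 2" by (simp add: card_insert_if)
    finally show "card {x. x\<^sup>2 = s} \<le> 2" .
  qed
  also have "\<dots> = 2 * (card ?S - 1)"
    by (simp add: card_Diff_singleton image_iff)
  finally have "CARD('a) - 1 \<le> 2 * (card ?S - 1)" by (simp add: card_Diff_singleton)
  moreover have "card ?S > 0" by (simp add: card_gt_0_iff)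
  ultimately show ?thesis by linarith
qed

text \<open>Pigeonhole: the values \<open>a * u^2\<close> and \<open>c - b * v^2\<close> each fill
  more than half of the field, so they meet.\<close>

lemma binary_form_represents:
  fixes a b c :: "'a::{finite,field}"
  assumes "a \<noteq> 0" "b \<noteq> 0"
  obtains u v where "a * u\<^sup>2 + b * v\<^sup>2 = c"
proof -
  let ?S = "range (\<lambda>x :: 'a. x\<^sup>2)"
  let ?A = "(\<lambda>s. a * s) ` ?S" and ?B = "(\<lambda>s. c - b * s) ` ?S"
  have "card ?A = card ?S" "card ?B = card ?S"
    by (rule card_image; use assms in \<open>auto simp: inj_on_def\<close>)+
  moreover have "card (?A \<union> ?B) \<le> CARD('a)" by (rule card_mono) auto
  ultimately have "?A \<inter> ?B \<noteq> {}"
    using card_squares[where 'a = 'a] card_Un_disjoint[of ?A ?B] by auto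
  then obtain u v where "a * u\<^sup>2 = c - b * v\<^sup>2" by auto
  then show thesis using that[of u v] by simp
qed

section \<open>Reducing the diagonal form to hyperbolic planes\<close>

text \<open>A sum over values of the form rather than a count of zeros: translating \<open>F\<close>
  absorbs the variables already fixed, and the list recursion exposes the leading pair for
  substitution.\<close>

fun diag_sum :: "nat \<Rightarrow> 'a::{finite,field} list \<Rightarrow> ('a poly \<Rightarrow> real) \<Rightarrow> real" where
  "diag_sum P [] F = F 0"
| "diag_sum P (c # cs) F = (\<Sum>x\<in>polys_below P. diag_sum P cs (\<lambda>w. F (w + smult c (x\<^sup>2))))"

fun hyperbolic_sum :: "nat \<Rightarrow> nat \<Rightarrow> ('a::{finite,field} poly \<Rightarrow> real) \<Rightarrow> real" where
  "hyperbolic_sum P 0 F = F 0"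
| "hyperbolic_sum P (Suc m) F =
    (\<Sum>y\<in>polys_below P. \<Sum>z\<in>polys_below P. hyperbolic_sum P m (\<lambda>w. F (w + y * z)))"

text \<open>Turns scalars into ring elements, so that identities between forms become commutative
  ring identities.\<close>

lemma smult_as_ring_mult:
  obtains C :: "'a::field \<Rightarrow> 'a poly" where "\<And>c p. smult c p = C c * p"
    "\<And>b c. C (b * c) = C b * C c" "\<And>b c. C (b + c) = C b + C c" "\<And>c. C (- c) = - C c" "C 1 = 1"
  using that[of "\<lambda>c. [:c:]"] by (simp add: one_pCons)

text \<open>A constant matrix preserves the degree bound. It is injective on pairs by Cramer's rule,
  hence bijective by finiteness.\<close>

lemma sum_linear_substitution:
  fixes G :: "'a::{finite,field} poly \<Rightarrow> 'a poly \<Rightarrow> real"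
  assumes det: "p * s - r * t \<noteq> 0"
  shows "(\<Sum>x\<in>polys_below P. \<Sum>y\<in>polys_below P. G x y)
    = (\<Sum>x\<in>polys_below P. \<Sum>y\<in>polys_below P. G (smult p x + smult r y) (smult t x + smult s y))"
proof -
  let ?V = "polys_below P :: 'a poly set"
  let ?f = "\<lambda>(x, y). (smult p x + smult r y, smult t x + smult s y)"
  have "inj_on ?f (?V \<times> ?V)"
  proof (rule inj_onI, clarsimp)
    fix x y x' y' :: "'a poly"
    assume 1: "smult p x + smult r y = smult p x' + smult r y'"
      and 2: "smult t x + smult s y = smult t x' + smult s y'"
    let ?D = "p * s - r * t"
    have x: "smult ?D x = smult s (smult p x + smult r y) - smult r (smult t x + smult s y)" for x y :: "'a poly"
      by (simp add: smult_add_right smult_diff_left mult.commute)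
    have y: "smult ?D y = smult p (smult t x + smult s y) - smult t (smult p x + smult r y)" for x y :: "'a poly"
      by (simp add: smult_add_right smult_diff_left mult.commute)
    have "smult ?D x = smult ?D x'" "smult ?D y = smult ?D y'"
      by (simp_all only: x[of x y] x[of x' y'] y[of y x] y[of y' x'] 1 2)
    moreover have "x = x'" if "smult ?D x = smult ?D x'" for x x' :: "'a poly"
    proof -
      have "smult ?D (x - x') = 0" using that by (simp only: smult_diff_right diff_self)
      then show ?thesis using det by (simp only: smult_eq_0_iff) simp
    qed
    ultimately show "x = x' \<and> y = y'" by blast
  qed
  moreover have "?f ` (?V \<times> ?V) \<subseteq> ?V \<times> ?V"
    by (auto simp: polys_below_iff)
  ultimately have "bij_betw ?f (?V \<times> ?V) (?V \<times> ?V)"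
    by (simp add: bij_betw_def endo_inj_surj)
  from sum.reindex_bij_betw[OF this, of "\<lambda>(x, y). G x y"]
  show ?thesis by (simp add: sum.cartesian_product case_prod_unfold)
qed

text \<open>Let the form take the value \<open>c\<close> at \<open>(u, v)\<close>. The vector
  \<open>(- b * v, a * u)\<close> is orthogonal to it and has value \<open>a * b * c\<close>;
  scaling by \<open>s\<close> gives \<open>d\<close>. The change of basis has determinant
  \<open>s * c\<close>.\<close>

lemma diag_sum_replace_pair:
  fixes a b c d s :: "'a::{finite,field}"
  assumes nz: "a \<noteq> 0" "b \<noteq> 0" "c \<noteq> 0" "s \<noteq> 0" and d: "a * b * c * s\<^sup>2 = d"
  shows "diag_sum P (a # b # cs) F = diag_sum P (c # d # cs) F"
proof -
  obtain u v where uv: "a * u\<^sup>2 + b * v\<^sup>2 = c" using binary_form_represents[OF nz(1,2)] by blast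
  let ?G = "\<lambda>w. diag_sum P cs (\<lambda>w'. F (w' + w))"
  have "u * (a * u * s) - (- b * v * s) * v = s * c"
    using uv[symmetric] by (simp add: algebra_simps power2_eq_square)
  then have det: "u * (a * u * s) - (- b * v * s) * v \<noteq> 0" using nz by simp
  have form: "smult b ((smult v x + smult (a * u * s) y)\<^sup>2) + smult a ((smult u x + smult (- b * v * s) y)\<^sup>2)
      = smult d (y\<^sup>2) + smult c (x\<^sup>2)" for x y
  proof -
    obtain C :: "'a \<Rightarrow> 'a poly" where "\<And>c p. smult c p = C c * p"
      "\<And>b c. C (b * c) = C b * C c" "\<And>b c. C (b + c) = C b + C c" "\<And>c. C (- c) = - C c" "C 1 = 1"
      by (rule smult_as_ring_mult) blast
    note C = this
    show ?thesis
      unfolding d[symmetric] uv[symmetric] power2_eq_square C by (simp add: algebra_simps)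
  qed
  have "diag_sum P (a # b # cs) F
      = (\<Sum>x\<in>polys_below P. \<Sum>y\<in>polys_below P. ?G (smult b (y\<^sup>2) + smult a (x\<^sup>2)))"
    by (simp add: add.assoc)
  also have "\<dots> = (\<Sum>x\<in>polys_below P. \<Sum>y\<in>polys_below P. ?G (smult d (y\<^sup>2) + smult c (x\<^sup>2)))"
    by (subst sum_linear_substitution[OF det]) (simp only: form)
  also have "\<dots> = diag_sum P (c # d # cs) F"
    by (simp add: add.assoc)
  finally show ?thesis .
qed

text \<open>With \<open>h = 1 / 2\<close>, the difference of the squares of
  \<open>h * (y + z)\<close> and \<open>h * (y - z)\<close> is \<open>y * z\<close>.\<close>

lemma diag_sum_hyperbolic_plane:
  assumes "(2 :: 'a::{finite,field}) \<noteq> 0"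
  shows "diag_sum P (1 # - 1 # cs) F
    = (\<Sum>y\<in>polys_below P. \<Sum>z\<in>polys_below P. diag_sum P cs (\<lambda>w. F (w + y * z :: 'a poly)))"
proof -
  let ?G = "\<lambda>w. diag_sum P cs (\<lambda>w'. F (w' + w))"
  define h where "h = (1 / 2 :: 'a)"
  have h: "h + h = 1" using assms by (simp add: h_def field_simps)
  \<comment> \<open>Written as an iterated sum to match the coefficient of \<open>x * y\<close> in
    \<open>form\<close>.\<close>
  then have h4: "h * h + (h * h + (h * h + h * h)) = 1"
    by (metis add.assoc distrib_left distrib_right mult_1)
  have "h * (- h) - h * h \<noteq> 0"
  proof
    assume "h * (- h) - h * h = 0"
    then have "h * (h + h) = 0" by (simp add: algebra_simps)
    then show False using h by auto
  qed
  note det = this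
  have form: "smult (- 1) ((smult h x + smult (- h) y)\<^sup>2) + smult 1 ((smult h x + smult h y)\<^sup>2) = x * y" for x y
  proof -
    obtain C :: "'a \<Rightarrow> 'a poly" where "\<And>c p. smult c p = C c * p"
      "\<And>b c. C (b * c) = C b * C c" "\<And>b c. C (b + c) = C b + C c" "\<And>c. C (- c) = - C c" "C 1 = 1"
      by (rule smult_as_ring_mult) blast
    note C = this
    have "smult (- 1) ((smult h x + smult (- h) y)\<^sup>2) + smult 1 ((smult h x + smult h y)\<^sup>2)
      = smult (h * h + (h * h + (h * h + h * h))) (x * y)"
      unfolding C power2_eq_square by (simp add: algebra_simps)
    then show ?thesis using h4 by simp
  qed
  have "diag_sum P (1 # - 1 # cs) F
      = (\<Sum>x\<in>polys_below P. \<Sum>y\<in>polys_below P. ?G (smult (- 1) (y\<^sup>2) + smult 1 (x\<^sup>2)))"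
    by (simp only: diag_sum.simps add.assoc)
  also have "\<dots> = (\<Sum>x\<in>polys_below P. \<Sum>y\<in>polys_below P. ?G (x * y))"
    by (subst sum_linear_substitution[OF det]) (simp only: form)
  finally show ?thesis .
qed

text \<open>Planes are split off one at a time. With at least four coefficients left, a third one
  absorbs the discriminant; the square condition is spent only on the last pair.\<close>

lemma diag_sum_eq_hyperbolic_sum:
  fixes cs :: "'a::{finite,field} list"
  assumes two: "(2 :: 'a) \<noteq> 0"
  assumes "length cs = 2 * m" "0 \<notin> set cs" "(- 1) ^ m * prod_list cs = \<beta>\<^sup>2"
  shows "diag_sum P cs F = hyperbolic_sum P m F"
  using assms(2-)
proof (induction m arbitrary: cs F)
  case (Suc m)
  then obtain a b r where cs: "cs = a # b # r" and r: "length r = 2 * m"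
    by (auto simp: length_Suc_conv)
  have nz: "a \<noteq> 0" "b \<noteq> 0" "0 \<notin> set r" using Suc.prems cs by auto
  show ?case
  proof (cases r)
    case Nil
    then have "- (a * b) = \<beta>\<^sup>2" using Suc.prems cs r by simp
    then have ab: "a * b = - (\<beta>\<^sup>2)" by (metis minus_minus)
    then have \<beta>: "\<beta> \<noteq> 0" using nz by auto
    \<comment> \<open>The discriminant gives \<open>a * b = - (\<beta>^2)\<close>, so scaling by
      \<open>1 / \<beta>\<close> makes the second coefficient \<open>- 1\<close>.\<close>
    have "diag_sum P cs F = diag_sum P [1, - 1] F"
      unfolding cs Nil
      by (rule diag_sum_replace_pair[where s = "1 / \<beta>"]) (use nz \<beta> ab in \<open>auto simp: power_divide\<close>)
    also have "\<dots> = (\<Sum>y\<in>polys_below P. \<Sum>z\<in>polys_below P. diag_sum P [] (\<lambda>w. F (w + y * z)))"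
      by (rule diag_sum_hyperbolic_plane[OF two])
    finally show ?thesis using r Nil by simp
  next
    case (Cons c r')
    \<comment> \<open>The leading coefficients pass from \<open>a, b, c\<close> to
      \<open>1, a * b, c\<close> and then to \<open>1, - 1, ?d\<close>. The sign in
      \<open>?d\<close> offsets the loss of one factor \<open>- 1\<close>, so the tail satisfies the
      same discriminant condition.\<close>
    let ?d = "- (a * b * c)"
    have c: "c \<noteq> 0" using nz Cons by auto
    have "diag_sum P cs F = diag_sum P (1 # a * b # c # r') F"
      unfolding cs Cons by (rule diag_sum_replace_pair[where s = 1]) (use nz in auto)
    also have "\<dots> = diag_sum P (1 # - 1 # ?d # r') F"
      unfolding diag_sum.simps(2)[of P 1]
      by (intro sum.cong refl diag_sum_replace_pair[where s = 1]) (use nz c in auto)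
    also have "\<dots> = (\<Sum>y\<in>polys_below P. \<Sum>z\<in>polys_below P. diag_sum P (?d # r') (\<lambda>w. F (w + y * z)))"
      by (rule diag_sum_hyperbolic_plane[OF two])
    also have "\<dots> = hyperbolic_sum P (Suc m) F"
      unfolding hyperbolic_sum.simps
      by (intro sum.cong refl Suc.IH) (use Suc.prems cs Cons r nz in \<open>auto simp: mult.assoc\<close>)
    finally show ?thesis .
  qed
qed simp

text \<open>The list is reversed so that the newest coefficient \<open>a n\<close> is at its head,
  where the recursion peels it off.\<close>

lemma diag_sum_eq_sum_tuples:
  fixes a :: "nat \<Rightarrow> 'a::{finite,field}"
  shows "diag_sum P (rev (map a [0..<n])) F =
    (\<Sum>x | (\<forall>i<n. x i \<in> polys_below P) \<and> (\<forall>i\<ge>n. x i = 0). F (\<Sum>i<n. smult (a i) ((x i)\<^sup>2)))"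
proof (induction n arbitrary: F)
  case 0
  have "{x :: nat \<Rightarrow> 'a poly. \<forall>i. x i = 0} = {\<lambda>_. 0}" by auto
  then show ?case by simp
next
  case (Suc n)
  let ?T = "\<lambda>n. {x :: nat \<Rightarrow> 'a poly. (\<forall>i<n. x i \<in> polys_below P) \<and> (\<forall>i\<ge>n. x i = 0)}"
  have "diag_sum P (rev (map a [0..<Suc n])) F =
     (\<Sum>c\<in>polys_below P. \<Sum>x\<in>?T n. F ((\<Sum>i<n. smult (a i) ((x i)\<^sup>2)) + smult (a n) (c\<^sup>2)))"
    by (simp add: Suc.IH)
  also have "\<dots> = (\<Sum>(c, x)\<in>polys_below P \<times> ?T n. F ((\<Sum>i<n. smult (a i) ((x i)\<^sup>2)) + smult (a n) (c\<^sup>2)))"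
    by (rule sum.cartesian_product)
  also have "\<dots> = (\<Sum>x\<in>?T (Suc n). F (\<Sum>i<Suc n. smult (a i) ((x i)\<^sup>2)))"
    by (rule sum.reindex_bij_witness[of _ "\<lambda>x. (x n, x(n := 0))" "\<lambda>(c, x). x(n := c)"])
      (auto simp: less_Suc_eq intro!: arg_cong[where f = F] sum.cong)
  finally show ?case .
qed

lemma N_count_eq_diag_sum:
  fixes a :: "nat \<Rightarrow> 'a::{finite,field}"
  shows "real (N_count n a P) = diag_sum P (rev (map a [0..<n])) (\<lambda>w. of_bool (w = 0))"
proof -
  let ?T = "{x :: nat \<Rightarrow> 'a poly. (\<forall>i<n. x i \<in> polys_below P) \<and> (\<forall>i\<ge>n. x i = 0)}"
  have "?T = {x. \<forall>i. (i \<in> {..<n} \<longrightarrow> x i \<in> polys_below P) \<and> (i \<notin> {..<n} \<longrightarrow> x i = 0)}" by auto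
  also have "finite \<dots>" by (rule finite_set_of_finite_funs) auto
  finally have "finite ?T" .
  then show ?thesis
    unfolding diag_sum_eq_sum_tuples N_count_def
    by (simp add: Int_def polys_below_def conj_assoc)
qed

section \<open>Detecting the equation by functionals\<close>

text \<open>All values of the form lie in \<open>polys_below (2 * P - 1)\<close>, so
  \<open>F\<close> is never evaluated elsewhere.\<close>

lemma hyperbolic_sum_cong:
  assumes "\<And>w. w \<in> polys_below (2 * P - 1) \<Longrightarrow> F w = G w"
  shows "hyperbolic_sum P m F = hyperbolic_sum P m G"
  using assms
proof (induction m arbitrary: F G)
  case (Suc m)
  show ?case
    unfolding hyperbolic_sum.simps
  proof (intro sum.cong refl Suc.IH Suc.prems)
    fix y z w :: "'a poly"
    assume "y \<in> polys_below P" "z \<in> polys_below P" "w \<in> polys_below (2 * P - 1)"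
    moreover from this have "y * z \<in> polys_below (2 * P - 1)"
      using mult_in_polys_below[of y P z P] by (simp add: mult_2)
    ultimately show "w + y * z \<in> polys_below (2 * P - 1)"
      using poly_subspace_polys_below unfolding poly_subspace_def by blast
  qed
qed simp

lemma hyperbolic_sum_sum:
  "hyperbolic_sum P m (\<lambda>w. \<Sum>l\<in>A. G l w) = (\<Sum>l\<in>A. hyperbolic_sum P m (G l))"
proof (induction m arbitrary: G)
  case (Suc m)
  have "hyperbolic_sum P (Suc m) (\<lambda>w. \<Sum>l\<in>A. G l w)
    = (\<Sum>y\<in>polys_below P. \<Sum>z\<in>polys_below P. \<Sum>l\<in>A. hyperbolic_sum P m (\<lambda>w. G l (w + y * z)))"
    by (simp add: Suc.IH)
  also have "\<dots> = (\<Sum>l\<in>A. \<Sum>y\<in>polys_below P. \<Sum>z\<in>polys_below P. hyperbolic_sum P m (\<lambda>w. G l (w + y * z)))"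
    by (subst sum.swap[of _ A]) (simp only: sum.swap[of _ A])
  finally show ?case by simp
qed simp

lemma hyperbolic_sum_mult:
  "hyperbolic_sum P m (\<lambda>w. r * F w) = r * hyperbolic_sum P m F"
  by (induction m arbitrary: F) (simp_all add: sum_distrib_left)

text \<open>Fixing one pair \<open>y\<close>, \<open>z\<close> translates \<open>g\<close>, and
  translates of a balanced weight are balanced, so the induction applies. Each pair then gives one
  factor: only \<open>y\<close> in the kernel survives, with \<open>z\<close> free.\<close>

lemma hyperbolic_sum_pairing:
  fixes g :: "'a::{finite,field} \<Rightarrow> real"
  assumes "(\<Sum>c\<in>UNIV. g c) = 0"
  shows "hyperbolic_sum P m (\<lambda>w. g (pairing N l w))
    = (real (card (hankel_kernel N l P P)) * real CARD('a) ^ P) ^ m * g 0"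
  using assms
proof (induction m arbitrary: g)
  case (Suc m)
  let ?V = "polys_below P :: 'a poly set" and ?K = "hankel_kernel N l P P"
  let ?D = "real (card ?K) * real CARD('a) ^ P"
  have shift: "(\<Sum>c\<in>UNIV. g (c + e)) = 0" for e
    using sum.reindex_bij_witness[of UNIV "\<lambda>c. c - e" "\<lambda>c. c + e" UNIV g "\<lambda>c. g (c + e)"] Suc.prems
    by simp
  have "hyperbolic_sum P (Suc m) (\<lambda>w. g (pairing N l w))
      = (\<Sum>y\<in>?V. \<Sum>z\<in>?V. hyperbolic_sum P m (\<lambda>w. g (pairing N l w + pairing N l (y * z))))"
    by (simp add: pairing_add_right)
  also have "\<dots> = (\<Sum>y\<in>?V. \<Sum>z\<in>?V. ?D ^ m * g (pairing N l (y * z)))"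
    by (intro sum.cong refl, subst Suc.IH[OF shift]) simp
  also have "\<dots> = ?D ^ m * (\<Sum>y\<in>?V. of_bool (y \<in> ?K) * (real CARD('a) ^ P * g 0))"
    by (simp add: sum_distrib_left[symmetric] sum_hankel_row[OF _ Suc.prems] mult.assoc)
  also have "(\<Sum>y\<in>?V. of_bool (y \<in> ?K) * (real CARD('a) ^ P * g 0)) = real (card ?K) * (real CARD('a) ^ P * g 0)"
  proof -
    have "?V \<inter> ?K = ?K" by (auto simp: hankel_kernel_def)
    then show ?thesis by (simp add: sum_distrib_right[symmetric])
  qed
  finally show ?case by (simp add: mult_ac)
qed simp

text \<open>The indicator of zero is expanded over all functionals; each contributes a power of its
  kernel size, and the moment formula sums these.\<close>

lemma hyperbolic_sum_delta:
  assumes "P \<ge> 1"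
  defines "q \<equiv> real CARD('a::{finite,field})"
  shows "q ^ (2 * P - 1) * hyperbolic_sum P m (\<lambda>w :: 'a poly. of_bool (w = 0))
    = (q ^ P) ^ m * (q ^ (2 * P - 1) + (q ^ m - 1) * (\<Sum>i<P. (q ^ 2) ^ i * (q ^ m) ^ (P - Suc i)))"
proof -
  define N where "N = 2 * P - 1"
  let ?W = "polys_below N :: 'a poly set" and ?d = "balanced_delta (0 :: 'a)"
  let ?k = "\<lambda>l :: 'a poly. real (card (hankel_kernel N l P P))"
  have "q ^ N * ?d * hyperbolic_sum P m (\<lambda>w :: 'a poly. of_bool (w = 0))
      = hyperbolic_sum P m (\<lambda>w :: 'a poly. q ^ N * ?d * of_bool (w = 0))"
    by (simp only: hyperbolic_sum_mult)
  also have "\<dots> = hyperbolic_sum P m (\<lambda>w. \<Sum>l\<in>?W. balanced_delta (pairing N l w))"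
  proof (rule hyperbolic_sum_cong)
    fix w :: "'a poly" assume "w \<in> polys_below (2 * P - 1)"
    from sum_balanced_delta_pairing[OF this]
    show "q ^ N * ?d * of_bool (w = 0) = (\<Sum>l\<in>?W. balanced_delta (pairing N l w))"
      by (simp only: N_def q_def mult_ac)
  qed
  also have "\<dots> = (\<Sum>l\<in>?W. (?k l * q ^ P) ^ m * ?d)"
    by (simp only: hyperbolic_sum_sum hyperbolic_sum_pairing[OF sum_balanced_delta] q_def)
  also have "\<dots> = (q ^ P) ^ m * (\<Sum>l\<in>?W. ?k l ^ m) * ?d"
    by (simp add: sum_distrib_left sum_distrib_right power_mult_distrib mult_ac)
  \<comment> \<open>Both expansions carry the positive factor \<open>?d\<close>, which
    cancels.\<close>
  finally have "q ^ N * hyperbolic_sum P m (\<lambda>w :: 'a poly. of_bool (w = 0)) = (q ^ P) ^ m * (\<Sum>l\<in>?W. ?k l ^ m)"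
    using balanced_delta_0_pos[where 'a = 'a] by simp
  also have "(\<Sum>l\<in>?W. ?k l ^ m) = q ^ N + (\<Sum>l\<in>?W. ?k l ^ m - 1)"
    by (simp add: sum_subtractf card_polys_below q_def)
  also have "Suc N - P = P" using assms by (simp add: N_def)
  then have "(\<Sum>l\<in>?W. ?k l ^ m - 1) = (q ^ m - 1) * (\<Sum>i<P. (q ^ 2) ^ i * (q ^ m) ^ (P - Suc i))"
    using sum_card_hankel_kernel_power[of P N m, where 'a = 'a] assms by (simp add: N_def)
  finally show ?thesis by (simp add: N_def)
qed

section \<open>Evaluation of the closed formulas\<close>

theorem theorem5p4:
  fixes a :: "nat \<Rightarrow> 'a::{finite,field}" and n P :: nat
  assumes odd_q: "odd (card (UNIV::'a set))"
    and n_even: "even n" and n_ge: "n \<ge> 4"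
    and a_nz: "\<forall>i<n. a i \<noteq> 0"
    and sq: "\<exists>b::'a. b \<noteq> 0 \<and> (-1)^(n div 2) * (\<Prod>i<n. a i) = b^2"
    and P_ge: "P \<ge> 1"
  shows "(n = 4 \<longrightarrow> real (N_count n a P) =
            (real (card (UNIV::'a set))^2 - 1) / real (card (UNIV::'a set)) * real P * real (card (UNIV::'a set))^(2*P)
            + real (card (UNIV::'a set))^(2*P))
       \<and> (n \<ge> 6 \<longrightarrow> real (N_count n a P) =
            (real (card (UNIV::'a set))^(n div 2) - 1) / (real (card (UNIV::'a set))^(n div 2 - 1) - real (card (UNIV::'a set)))
              * real (card (UNIV::'a set))^(P*(n-2))
            - (real (card (UNIV::'a set)) - 1) * (real (card (UNIV::'a set))^(n div 2 - 1) + 1)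
              / (real (card (UNIV::'a set))^(n div 2 - 1) - real (card (UNIV::'a set))) * real (card (UNIV::'a set))^((n div 2)*P))"
proof -
  let ?N = "real (N_count n a P)"
  define q where "q = real CARD('a)"
  define m where "m = n div 2"
  define S where "S = (\<Sum>i<P. (q ^ 2) ^ i * (q ^ m) ^ (P - Suc i))"
  have n: "n = 2 * m" using n_even by (auto simp: m_def)
  have q1: "q > 1" using card_field_gt_1[where 'a = 'a] by (simp add: q_def)
  obtain \<beta> where "(- 1) ^ m * (\<Prod>i<n. a i) = \<beta>\<^sup>2" using sq m_def by auto
  moreover have "prod_list (rev (map a [0..<n])) = (\<Prod>i<n. a i)"
    by (induction n) (simp_all add: mult.commute)
  ultimately have disc: "(- 1) ^ m * prod_list (rev (map a [0..<n])) = \<beta>\<^sup>2" by simp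
  have "?N = hyperbolic_sum P m (\<lambda>w :: 'a poly. of_bool (w = 0))"
    unfolding N_count_eq_diag_sum
    by (rule diag_sum_eq_hyperbolic_sum[OF two_neq_0_if_odd_card[OF odd_q] _ _ disc])
      (use a_nz n in auto)
  then have main: "q ^ (2 * P - 1) * ?N = (q ^ P) ^ m * (q ^ (2 * P - 1) + (q ^ m - 1) * S)"
    using hyperbolic_sum_delta[OF P_ge, of m, where 'a = 'a] by (simp only: q_def S_def)
  have "?N = (q ^ 2 - 1) / q * real P * q ^ (2 * P) + q ^ (2 * P)" if "n = 4"
  proof -
    obtain p where p: "P = Suc p" using P_ge by (cases P) auto
    define A where "A = q ^ p"
    have A: "A > 0" using q1 by (simp add: A_def)
    have m: "m = 2" using that n by simp
    \<comment> \<open>For \<open>m = 2\<close> both bases in \<open>S\<close> are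
      \<open>q ^ 2\<close>, so its \<open>P\<close> terms coincide; this produces the linear factor
      \<open>P\<close>.\<close>
    have "S = (\<Sum>i<P. (q ^ 2) ^ (P - 1))"
      unfolding S_def m by (rule sum.cong) (auto simp flip: power_add)
    then have S: "S = real P * A\<^sup>2" by (simp add: p A_def flip: power_mult) (simp add: mult.commute)
    have pow: "q ^ (2 * P - 1) = q * A\<^sup>2" "q ^ (2 * P) = q\<^sup>2 * A\<^sup>2" "q ^ P = q * A"
      by (simp_all add: p A_def power2_eq_square mult_2 power_add)
    have "A\<^sup>2 * (q * ?N) = A\<^sup>2 * (q\<^sup>2 * A\<^sup>2 * (q + (q\<^sup>2 - 1) * real P))"
      using main unfolding m pow S by (simp add: algebra_simps power_mult_distrib)
    then have "q * ?N = q\<^sup>2 * A\<^sup>2 * (q + (q\<^sup>2 - 1) * real P)" using A by simp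
    then have "?N = q\<^sup>2 * A\<^sup>2 * (q + (q\<^sup>2 - 1) * real P) / q" using q1 by (simp add: field_simps)
    then show ?thesis unfolding pow using q1 by (simp add: field_simps)
  qed
  moreover have "?N = (q ^ m - 1) / (q ^ (m - 1) - q) * q ^ (P * (n - 2))
      - (q - 1) * (q ^ (m - 1) + 1) / (q ^ (m - 1) - q) * q ^ (m * P)" if "n \<ge> 6"
  proof -
    define R B D where "R = q ^ (m - 1)" and "B = (q ^ P) ^ m" and "D = q ^ (2 * P)"
    have m: "m \<ge> 3" using that n by simp
    \<comment> \<open>The common denominator \<open>R - q\<close> is positive because
      \<open>m - 1 \<ge> 2\<close>.\<close>
    have "q ^ 1 < q ^ (m - 1)" by (rule power_strict_increasing) (use m q1 in auto)
    then have R: "R - q > 0" by (simp add: R_def)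
    have qm: "q ^ m = q * R" using m by (simp add: R_def flip: power_Suc)
    have pos: "B > 0" "D > 0" using q1 by (simp_all add: B_def D_def)
    have "D = q * q ^ (2 * P - 1)" using P_ge by (simp add: D_def flip: power_Suc)
    then have "D * ?N = q * (q ^ (2 * P - 1) * ?N)" by simp
    also have "\<dots> = B * (D + (q * R - 1) * (q * S))"
      unfolding main qm B_def[symmetric] \<open>D = q * q ^ (2 * P - 1)\<close> by (simp add: algebra_simps)
    finally have 1: "D * ?N = B * (D + (q * R - 1) * (q * S))" .
    \<comment> \<open>\<open>S\<close> is the cofactor in the factorization of a difference of
      \<open>P\<close>-th powers.\<close>
    have "(q ^ 2) ^ P - (q ^ m) ^ P = (q ^ 2 - q ^ m) * S"
      unfolding S_def power_diff_sumr2 by (simp add: mult.commute)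
    moreover have "(q ^ 2) ^ P = D" "(q ^ m) ^ P = B"
      by (simp_all add: D_def B_def mult.commute flip: power_mult)
    ultimately have 2: "(R - q) * (q * S) = B - D"
      by (simp add: qm algebra_simps power2_eq_square)
    have "(R - q) * (D * ?N) = B * ((R - q) * D + (q * R - 1) * ((R - q) * (q * S)))"
      unfolding 1 by (simp add: algebra_simps)
    then have "(R - q) * (D * ?N) = (q * R - 1) * B\<^sup>2 - (q - 1) * (R + 1) * (B * D)"
      unfolding 2 by (simp add: algebra_simps power2_eq_square)
    then have "?N = ((q * R - 1) * B\<^sup>2 - (q - 1) * (R + 1) * (B * D)) / ((R - q) * D)"
      using R pos by (simp add: field_simps)
    also have "\<dots> = (q * R - 1) / (R - q) * (B\<^sup>2 / D) - (q - 1) * (R + 1) / (R - q) * B"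
      using R pos unfolding diff_divide_distrib[of "(q * R - 1) * B\<^sup>2"] by simp
    also have "B\<^sup>2 / D = q ^ (P * (n - 2))"
    proof -
      have "P * (n - 2) + 2 * P = P * m * 2"
        using m unfolding n by (simp add: algebra_simps)
      then have "q ^ (P * (n - 2)) * D = B\<^sup>2"
        unfolding B_def D_def by (simp flip: power_add power_mult)
      then show ?thesis using pos by (simp add: field_simps)
    qed
    also have "B = q ^ (m * P)" by (simp add: B_def mult.commute flip: power_mult)
    finally show ?thesis by (simp only: R_def qm)
  qed
  ultimately show ?thesis unfolding q_def m_def by blast
qed

end
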